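(* Let $V$ be a vector space of finite dimension $n\geq 2$ over a field $\mathbb{F}$, endowed with a symplectic form of maximal rank. Then the pre-geometry $\Gamma=\Gamma(V)$ is residually connected.
   Context: For $U\le V$ let $U^\perp$ be its orthogonal with respect to the form and $\mathrm{Rad}(U)=U\cap U^\perp$. Maximal rank means $\dim\mathrm{Rad}(V)=0$ if $n$ is even and $1$ if $n$ is odd. $\Gamma(V)$ has type set $I=\{1,\dots,n-1\}$. Its objects of type $i$ are the $i$-dimensional subspaces $U\le V$ with $U\cap\mathrm{Rad}(V)=0$ and $\dim\mathrm{Rad}(U)\le 1$. Each object is incident with itself, and objects $X,Y$ with $\dim X<\dim Y$ are incident iff $X\subseteq Y$ and $X\cap\mathrm{Rad}(Y)=0$. Distinct objects of equal dimension are not incident. A flag is a (possibly empty) set of pairwise incident objects. The residue of a flag $F$ consists of all objects not in $F$ that are incident with every element of $F$, with the induced types and incidence; its rank is $|I|-|F|$. A pre-geometry is connected if its incidence graph is connected. $\Gamma$ is residually connected if every residue of rank at least $2$ of a flag is connected. *)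

theory Defs
  imports "HOL.Vector_Spaces" "Graph_Theory.Digraph_Component"
begin

section \<open>Pre-geometries\<close>

record ('o, 't) pregeometry =
  type_set :: "'t set"
  objects :: "'o set"
  type_of :: "'o \<Rightarrow> 't"
  incident :: "'o \<Rightarrow> 'o \<Rightarrow> bool"

definition is_flag :: "('o, 't) pregeometry \<Rightarrow> 'o set \<Rightarrow> bool" where
  "is_flag G F \<longleftrightarrow> F \<subseteq> objects G \<and> (\<forall>x\<in>F. \<forall>y\<in>F. incident G x y)"

definition residue :: "('o, 't) pregeometry \<Rightarrow> 'o set \<Rightarrow> ('o, 't) pregeometry" where
  "residue G F =
    \<lparr>type_set = type_set G - type_of G ` F,
     objects = {x \<in> objects G - F. \<forall>y\<in>F. incident G x y},
     type_of = type_of G,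
     incident = incident G\<rparr>"

text \<open>
  In a pre-geometry with finite type set, a flag \<open>F\<close> is finite, its elements having
  pairwise distinct types, so that \<open>card F\<close> is its size and the subtraction
  below does not truncate.
\<close>
definition residue_rank :: "('o, 't) pregeometry \<Rightarrow> 'o set \<Rightarrow> nat" where
  "residue_rank G F = card (type_set G) - card F"

text \<open>Loops coming from the reflexivity of incidence are dropped.\<close>
definition incidence_graph :: "('o, 't) pregeometry \<Rightarrow> 'o pair_pre_digraph" where
  "incidence_graph G =
    \<lparr>pverts = objects G,
     parcs = {(x, y). x \<in> objects G \<and> y \<in> objects G \<and> x \<noteq> y \<and> incident G x y}\<rparr>"

text \<open>Connectedness in \<open>Graph_Theory\<close> includes that there is at least one vertex.\<close>
definition connected_pregeometry :: "('o, 't) pregeometry \<Rightarrow> bool" where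
  "connected_pregeometry G \<longleftrightarrow> connected (with_proj (incidence_graph G))"

definition residually_connected :: "('o, 't) pregeometry \<Rightarrow> bool" where
  "residually_connected G \<longleftrightarrow>
    (\<forall>F. is_flag G F \<and> residue_rank G F \<ge> 2 \<longrightarrow> connected_pregeometry (residue G F))"


section \<open>Spaces with an alternating bilinear form, and their pre-geometry\<close>

text \<open>
  The vector space is the whole type \<open>'v\<close>; the parameter \<open>Basis\<close>, some finite basis, only
  expresses finite-dimensionality. The form may be degenerate.
\<close>
locale symplectic_form_space = finite_dimensional_vector_space scale Basis
  for scale :: "'f::field \<Rightarrow> 'v::ab_group_add \<Rightarrow> 'v" (infixr \<open>*s\<close> 75)
    and Basis :: "'v set" +
  fixes form :: "'v \<Rightarrow> 'v \<Rightarrow> 'f"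
  assumes linear_left: "Vector_Spaces.linear scale (*) (\<lambda>x. form x y)"
    and linear_right: "Vector_Spaces.linear scale (*) (form x)"
    and alternating: "form x x = 0"

definition perp :: "('v \<Rightarrow> 'v \<Rightarrow> 'f::zero) \<Rightarrow> 'v set \<Rightarrow> 'v set" where
  "perp form U = {v. \<forall>u\<in>U. form u v = 0}"

definition Rad :: "('v \<Rightarrow> 'v \<Rightarrow> 'f::zero) \<Rightarrow> 'v set \<Rightarrow> 'v set" where
  "Rad form U = U \<inter> perp form U"

context vector_space
begin

definition maximal_rank :: "('b \<Rightarrow> 'b \<Rightarrow> 'a) \<Rightarrow> bool" where
  "maximal_rank form \<longleftrightarrow> dim (Rad form UNIV) = (if even (dim UNIV) then 0 else 1)"

definition Gamma :: "('b \<Rightarrow> 'b \<Rightarrow> 'a) \<Rightarrow> ('b set, nat) pregeometry" where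
  "Gamma form =
    \<lparr>type_set = {1..dim UNIV - 1},
     objects = {U. subspace U \<and> dim U \<in> {1..dim UNIV - 1} \<and>
                   U \<inter> Rad form UNIV = {0} \<and> dim (Rad form U) \<le> 1},
     type_of = dim,
     incident = (\<lambda>X Y. X = Y \<or>
                   dim X < dim Y \<and> X \<subseteq> Y \<and> X \<inter> Rad form Y = {0} \<or>
                   dim Y < dim X \<and> Y \<subseteq> X \<and> Y \<inter> Rad form X = {0})\<rparr>"

end

end

theory Submission
  imports Defs
begin

text \<open>
  Call a subspace near-nondegenerate if its radical is at most a line, and write \<open>X \<prec> Y\<close> for
  \<open>X \<subset> Y\<close> with \<open>X \<inter> Rad Y = 0\<close>. The relation \<open>\<prec>\<close> is transitive, because \<open>X \<subseteq> Y\<close> and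
  \<open>Y \<inter> Rad Z = 0\<close> already give \<open>X \<inter> Rad Z = 0\<close>. The objects of \<open>\<Gamma>(V)\<close> are exactly the
  near-nondegenerate subspaces strictly between \<open>0\<close> and \<open>V\<close> for \<open>\<prec>\<close>, and incidence is
  comparability; \<open>0\<close> and, by maximal rank, \<open>V\<close> are near-nondegenerate themselves. So a flag is a
  chain, and its residue is the union of the open intervals between successive members of the
  chain from \<open>0\<close> to \<open>V\<close>; elements of different intervals are always incident. Everything reduces
  to two facts about one interval \<open>(X,Y)\<close>:

  \<^item> if \<open>dim Y \<ge> dim X + 2\<close>, it has an element of dimension \<open>dim X + 1\<close> (\<open>descend\<close>);
  \<^item> if \<open>dim Y \<ge> dim X + 3\<close>, any two elements of that dimension are joined by a path in it
    (\<open>minimal_elements_connected\<close>).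

  The first fact, applied to \<open>(X,U)\<close>, also joins every \<open>U\<close> in the interval to an element of
  dimension \<open>dim X + 1\<close>, so the interval is connected in the second situation. Both facts rest on
  one remark: a nondegenerate subspace precedes every larger subspace and follows every smaller
  one. If \<open>X\<close> is nondegenerate, the elements of dimension \<open>dim X + 1\<close> are of the form
  \<open>X + \<langle>p\<rangle>\<close>, and the radical of each is a line not in \<open>Rad Y\<close>. Given two of them, \<open>P\<close> and \<open>Q\<close>, a
  vector \<open>r\<close> of \<open>Y\<close> orthogonal to neither radical makes \<open>P + \<langle>r\<rangle>\<close> and \<open>Q + \<langle>r\<rangle>\<close> nondegenerate,
  which gives a path through \<open>X + \<langle>r\<rangle>\<close>. If \<open>Rad X = \<langle>x\<rangle>\<close>, the elements of dimension \<open>dim X + 1\<close>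
  are the nondegenerate subspaces \<open>X + \<langle>y\<rangle>\<close> with \<open>(x,y) \<noteq> 0\<close>. Two of them are joined by their
  sum unless it meets \<open>Rad Y\<close>, in which case a detour through a third one outside the sum works.
\<close>

section \<open>Linear algebra of radicals\<close>

context symplectic_form_space
begin

lemma form_add_left: "form (x + y) z = form x z + form y z"
  and form_scale_left: "form (c *s x) z = c * form x z"
  using linear_left[of z] by (simp_all add: Vector_Spaces.linear_iff)

lemma form_add_right: "form x (y + z) = form x y + form x z"
  and form_scale_right: "form x (c *s y) = c * form x y"
  using linear_right[of x] by (simp_all add: Vector_Spaces.linear_iff)

lemma form_zero_right [simp]: "form x 0 = 0"
  using form_scale_right[of x 0 0] by simp

lemma form_skew: "form x y = - form y x"
proof -
  have "0 = form (x + y) (x + y)" by (simp add: alternating)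
  also have "\<dots> = form x y + form y x"
    unfolding form_add_left form_add_right by (simp add: alternating)
  finally show ?thesis by (simp add: eq_neg_iff_add_eq_0)
qed

lemma form_sym_zero: "form x y = 0 \<longleftrightarrow> form y x = 0"
  using form_skew[of x y] by simp

lemma subspace_perp_vector: "subspace {v. form x v = 0}"
  by (rule subspaceI) (auto simp: form_add_right form_scale_right)

lemma subspace_perp: "subspace (perp form U)"
  by (rule subspaceI) (auto simp: perp_def form_add_right form_scale_right)

lemma mem_Rad: "v \<in> Rad form U \<longleftrightarrow> v \<in> U \<and> (\<forall>u\<in>U. form u v = 0)"
  by (auto simp: Rad_def perp_def)

lemma subspace_Rad: "subspace U \<Longrightarrow> subspace (Rad form U)"
  unfolding Rad_def by (intro subspace_inter subspace_perp)

lemma zero_mem_Rad: "subspace U \<Longrightarrow> 0 \<in> Rad form U"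
  by (rule subspace_0[OF subspace_Rad])

lemma Rad_inter_subset: "A \<subseteq> U \<Longrightarrow> A \<inter> Rad form U \<subseteq> Rad form A"
  by (auto simp: mem_Rad subset_iff)

lemma mem_span_insert:
  assumes "subspace A"
  shows "v \<in> span (insert p A) \<longleftrightarrow> (\<exists>k. \<exists>a\<in>A. v = a + k *s p)"
proof -
  have "v \<in> span (insert p A) \<longleftrightarrow> (\<exists>k. v - k *s p \<in> A)"
    using assms by (simp add: span_insert flip: span_eq_iff)
  then show ?thesis
    by (metis add_diff_cancel_right' diff_add_cancel)
qed

lemma subset_span_insert: "A \<subseteq> span (insert p A)"
  and mem_span_insert_self: "p \<in> span (insert p A)"
  by (auto intro: span_base)

lemma span_insert_subset: "subspace B \<Longrightarrow> A \<subseteq> B \<Longrightarrow> p \<in> B \<Longrightarrow> span (insert p A) \<subseteq> B"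
  by (simp add: span_minimal)

lemma dim_span_insert: "subspace A \<Longrightarrow> p \<notin> A \<Longrightarrow> dim (span (insert p A)) = dim A + 1"
  by (metis dim_insert dim_span span_eq_iff)

lemma dim_span_insert_le: "dim (span (insert p A)) \<le> dim A + 1"
  by (simp add: dim_insert)

lemma exists_mem_diff_of_dim_less:
  assumes "dim A < dim B"
  shows "\<exists>v\<in>B. v \<notin> A"
  using assms dim_subset[of B A] by (meson linorder_not_less subsetI)

lemma subspace_dim_le_one:
  assumes "subspace S" "dim S \<le> 1" "x \<in> S" "x \<noteq> 0"
  shows "S = span {x}"
proof -
  have "span {x} \<subseteq> S" using assms by (simp add: span_minimal)
  moreover have "dim S \<le> dim (span {x})" using assms by simp
  ultimately show ?thesis
    using subspace_dim_equal[of "span {x}" S] assms by simp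
qed

text \<open>Two conditions that each exclude a proper subspace can be met together, since a vector space
  is never the union of two proper subspaces, over any field.\<close>
lemma exists_mem_outside_two_subspaces:
  assumes "subspace Y" "subspace A" "subspace B" "a \<in> Y" "a \<notin> A" "b \<in> Y" "b \<notin> B"
  shows "\<exists>c\<in>Y. c \<notin> A \<and> c \<notin> B"
proof (cases "a \<in> B \<and> b \<in> A")
  case True
  then have "a + b \<notin> A" "a + b \<notin> B"
    using assms subspace_diff[of A "a + b" b] subspace_diff[of B "a + b" a] by auto
  then show ?thesis using assms subspace_add by blast
next
  case False
  then show ?thesis using assms by blast
qed

text \<open>Each vector of a basis of \<open>A\<close> imposes one linear equation.\<close>
lemma dim_le_dim_inter_perp:
  assumes "subspace U"
  shows "dim U \<le> dim (U \<inter> perp form A) + dim A"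
proof -
  have one: "dim W \<le> dim (W \<inter> {v. form b v = 0}) + 1" if W: "subspace W" for W b
  proof (cases "\<exists>w\<in>W. form b w \<noteq> 0")
    case True
    then obtain w where w: "w \<in> W" "form b w \<noteq> 0" by blast
    let ?K = "W \<inter> {v. form b v = 0}"
    have K: "subspace ?K" using W subspace_perp_vector by (rule subspace_inter)
    have "v \<in> span (insert w ?K)" if v: "v \<in> W" for v
    proof -
      let ?k = "form b v / form b w"
      have "form b (v - ?k *s w) = 0"
        using form_add_right[of b "v - ?k *s w" "?k *s w"] w by (simp add: form_scale_right)
      moreover have "v - ?k *s w \<in> W"
        using W v w by (simp add: subspace_diff subspace_scale)
      ultimately have "v - ?k *s w \<in> ?K" by simp
      then show ?thesis unfolding mem_span_insert[OF K] by (metis diff_add_cancel)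
    qed
    then have "dim W \<le> dim (span (insert w ?K))" by (intro dim_subset) blast
    then show ?thesis using dim_span_insert_le[of w ?K] by linarith
  next
    case False
    then have "W \<inter> {v. form b v = 0} = W" by auto
    then show ?thesis by simp
  qed
  obtain B where B: "B \<subseteq> A" "independent B" "A \<subseteq> span B" "card B = dim A"
    using basis_exists[of A] by blast
  have "dim U \<le> dim (U \<inter> perp form B) + card B"
    if "finite B" for B
    using that
  proof (induction B)
    case empty
    then show ?case by (simp add: perp_def)
  next
    case (insert b B)
    have "dim (U \<inter> perp form B) \<le> dim (U \<inter> perp form B \<inter> {v. form b v = 0}) + 1"
      by (intro one subspace_inter assms subspace_perp)
    moreover have "U \<inter> perp form B \<inter> {v. form b v = 0} = U \<inter> perp form (insert b B)"
      by (auto simp: perp_def)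
    ultimately show ?case using insert by simp
  qed
  then have "dim U \<le> dim (U \<inter> perp form B) + dim A"
    using B finiteI_independent by metis
  moreover have "perp form B \<subseteq> perp form A"
  proof
    fix v assume "v \<in> perp form B"
    then have "B \<subseteq> {u. form v u = 0}" by (auto simp: perp_def form_sym_zero[of v])
    then have "span B \<subseteq> {u. form v u = 0}" by (intro span_minimal subspace_perp_vector)
    then show "v \<in> perp form A" using B by (auto simp: perp_def form_sym_zero[of _ v])
  qed
  then have "dim (U \<inter> perp form B) \<le> dim (U \<inter> perp form A)" by (intro dim_subset) blast
  ultimately show ?thesis by linarith
qed

text \<open>The radical of the larger space meets \<open>A\<close> in \<open>Rad A = 0\<close>, and \<open>A\<close> is a hyperplane of it.\<close>
lemma dim_Rad_span_insert_le_one: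
  assumes A: "subspace A" "Rad form A = {0}"
  shows "dim (Rad form (span (insert p A))) \<le> 1"
proof -
  let ?U = "span (insert p A)"
  let ?R = "Rad form ?U"
  have R: "subspace ?R" by (simp add: subspace_Rad)
  have AR: "A \<inter> ?R \<subseteq> {0}" using Rad_inter_subset[OF subset_span_insert] A by metis
  show ?thesis
  proof (cases "?R \<subseteq> {0}")
    case True
    then show ?thesis by (simp flip: dim_eq_0)
  next
    case False
    then obtain u where u: "u \<in> ?R" "u \<noteq> 0" by blast
    then have "u \<in> ?U" by (simp add: mem_Rad)
    then obtain k a where a: "a \<in> A" "u = a + k *s p" unfolding mem_span_insert[OF A(1)] by blast
    have k: "k \<noteq> 0" using a u AR by auto
    have "v \<in> span {u}" if v: "v \<in> ?R" for v
    proof -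
      have "v \<in> ?U" using v by (simp add: mem_Rad)
      then obtain l b where b: "b \<in> A" "v = b + l *s p" unfolding mem_span_insert[OF A(1)] by blast
      have "v - (l / k) *s u = b - (l / k) *s a"
        using k by (simp add: a b scale_right_distrib)
      then have "v - (l / k) *s u \<in> A"
        using a(1) b(1) A(1) by (simp only: subspace_diff subspace_scale)
      moreover have "v - (l / k) *s u \<in> ?R"
        using R u v by (simp add: subspace_diff subspace_scale)
      ultimately have "v = (l / k) *s u" using AR by auto
      then show ?thesis by (simp add: span_base span_scale)
    qed
    then have "dim ?R \<le> dim (span {u})" by (intro dim_subset) blast
    then show ?thesis using u by simp
  qed
qed

text \<open>For dimension reasons \<open>A + \<langle>p\<rangle>\<close> contains a nonzero vector orthogonal to \<open>A\<close>. As it is also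
  orthogonal to itself and, with \<open>A\<close>, generates the whole space, it spans the radical.\<close>
lemma exists_Rad_span_insert:
  assumes A: "subspace A" "Rad form A = {0}" and p: "p \<notin> A"
  shows "\<exists>p'. p' \<noteq> 0 \<and> Rad form (span (insert p A)) = span {p'}"
proof -
  let ?U = "span (insert p A)"
  have "dim ?U = dim A + 1" using A(1) p by (rule dim_span_insert)
  then have "\<not> dim (?U \<inter> perp form A) = 0"
    using dim_le_dim_inter_perp[OF subspace_span, of "insert p A" A] by linarith
  then obtain u where u: "u \<in> ?U" "u \<in> perp form A" "u \<noteq> 0"
    unfolding dim_eq_0 by blast
  then obtain k a where a: "a \<in> A" "u = a + k *s p" unfolding mem_span_insert[OF A(1)] by blast
  have uA: "u \<notin> A" using u A by (auto simp: Rad_def)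
  then have k: "k \<noteq> 0" using a by auto
  \<comment> \<open>the whole space is also spanned by \<open>A\<close> and \<open>u\<close>, both orthogonal to \<open>u\<close>\<close>
  have "form v u = 0" if "v \<in> ?U" for v
  proof -
    obtain l b where b: "b \<in> A" "v = b + l *s p"
      using \<open>v \<in> ?U\<close> unfolding mem_span_insert[OF A(1)] by blast
    have "p = (1 / k) *s (u - a)" using a k by simp
    then have "v = (b - (l / k) *s a) + (l / k) *s u"
      using b by (simp add: scale_right_diff_distrib)
    moreover have "b - (l / k) *s a \<in> A"
      using a b A by (simp add: subspace_diff subspace_scale)
    then have "form (b - (l / k) *s a) u = 0" using u by (simp add: perp_def)
    ultimately show ?thesis by (simp add: form_add_left form_scale_left alternating)
  qed
  then have "u \<in> Rad form ?U" using u by (simp add: mem_Rad)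
  then show ?thesis
    using subspace_dim_le_one[OF subspace_Rad dim_Rad_span_insert_le_one[OF A, of p]] u
    by (metis subspace_span)
qed

text \<open>A vector of the new radical has no \<open>y\<close>-component because it is orthogonal to \<open>x\<close>; so it is a
  multiple of \<open>x\<close>, and the multiple is zero because it is orthogonal to \<open>y\<close>.\<close>
lemma Rad_span_insert_eq_zero:
  assumes A: "subspace A" and R: "Rad form A = span {x}" and y: "form x y \<noteq> 0"
  shows "Rad form (span (insert y A)) = {0}"
proof -
  let ?U = "span (insert y A)"
  have xA: "x \<in> Rad form A" using R by (simp add: span_base)
  have "v = 0" if v: "v \<in> Rad form ?U" for v
  proof -
    have vU: "v \<in> ?U" and v0: "\<And>u. u \<in> ?U \<Longrightarrow> form u v = 0" using v by (auto simp: mem_Rad)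
    obtain k a where a: "a \<in> A" "v = a + k *s y"
      using vU unfolding mem_span_insert[OF A(1)] by blast
    have "form x v = 0" using xA v0 subset_span_insert by (auto simp: mem_Rad)
    moreover have "form x a = 0" using xA a form_sym_zero[of x a] by (simp add: mem_Rad)
    ultimately have "k = 0" using y a by (simp add: form_add_right form_scale_right)
    then have "v = a" using a by simp
    then have "v \<in> Rad form A" using a v0 subset_span_insert by (auto simp: mem_Rad)
    then obtain c where c: "v = c *s x" using R by (auto simp: span_singleton)
    have "form v y = 0" using v0 mem_span_insert_self form_sym_zero by blast
    then show ?thesis using y c by (simp add: form_scale_left)
  qed
  then show ?thesis using zero_mem_Rad[of ?U] by auto
qed

lemma not_mem_of_not_perp_Rad:
  assumes "Rad form A = span {x}" "form x y \<noteq> 0"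
  shows "y \<notin> A"
proof
  assume "y \<in> A"
  moreover have "x \<in> Rad form A" using assms by (simp add: span_base)
  then have "form y x = 0" if "y \<in> A" using that unfolding mem_Rad by blast
  ultimately show False using assms form_sym_zero[of x y] by blast
qed

section \<open>The order on near-nondegenerate subspaces\<close>

definition near_nondegenerate :: "'v set \<Rightarrow> bool" where
  "near_nondegenerate U \<longleftrightarrow> subspace U \<and> dim (Rad form U) \<le> 1"

definition precedes :: "'v set \<Rightarrow> 'v set \<Rightarrow> bool" (infix \<open>\<prec>\<close> 50) where
  "X \<prec> Y \<longleftrightarrow> dim X < dim Y \<and> X \<subseteq> Y \<and> X \<inter> Rad form Y = {0}"

definition interval :: "'v set \<Rightarrow> 'v set \<Rightarrow> 'v set set" where
  "interval X Y = {U. near_nondegenerate U \<and> X \<prec> U \<and> U \<prec> Y}"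

definition comparability :: "'v set set \<Rightarrow> ('v set \<times> 'v set) set" where
  "comparability S = {(P, Q). P \<in> S \<and> Q \<in> S \<and> (P \<prec> Q \<or> Q \<prec> P)}"

lemma precedes_trans: "X \<prec> Y \<Longrightarrow> Y \<prec> Z \<Longrightarrow> X \<prec> Z"
  unfolding precedes_def by (auto intro: less_trans)

lemma precedes_dim: "X \<prec> Y \<Longrightarrow> dim X < dim Y"
  by (simp add: precedes_def)

lemma nondegenerate_precedes:
  assumes "Rad form A = {0}" "A \<subseteq> B" "dim A < dim B" "subspace B"
  shows "A \<prec> B"
proof -
  have "A \<inter> Rad form B \<subseteq> {0}" using Rad_inter_subset assms by metis
  moreover have "0 \<in> A" using assms(1) unfolding Rad_def by blast
  ultimately show ?thesis using assms zero_mem_Rad[of B] unfolding precedes_def by blast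
qed

lemma nondegenerate_near: "subspace U \<Longrightarrow> Rad form U = {0} \<Longrightarrow> near_nondegenerate U"
  by (simp add: near_nondegenerate_def)

lemma near_nondegenerate_cases:
  assumes "near_nondegenerate U"
  obtains "Rad form U = {0}" | x where "x \<noteq> 0" "Rad form U = span {x}"
proof (cases "Rad form U \<subseteq> {0}")
  case True
  then show ?thesis
    using that(1) assms zero_mem_Rad[of U] unfolding near_nondegenerate_def by blast
next
  case False
  then obtain x where "x \<in> Rad form U" "x \<noteq> 0" by blast
  then show ?thesis
    using that(2) assms subspace_dim_le_one[OF subspace_Rad] unfolding near_nondegenerate_def
    by blast
qed

lemma exists_not_perp:
  assumes "X \<prec> Y" "x \<in> X" "x \<noteq> 0"
  shows "\<exists>y\<in>Y. form x y \<noteq> 0"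
proof -
  have "x \<notin> Rad form Y" "x \<in> Y" using assms by (auto simp: precedes_def)
  then show ?thesis using form_sym_zero[of x] by (auto simp: mem_Rad)
qed

text \<open>Both cases choose a vector for which the extended space avoids \<open>Rad Y\<close>: either it lies
  outside the sum \<open>X + Rad Y\<close>, too small to exhaust \<open>Y\<close>, or the extension is nondegenerate.\<close>
lemma descend:
  assumes X: "near_nondegenerate X" and Y: "near_nondegenerate Y"
    and XY: "X \<prec> Y" "dim X + 2 \<le> dim Y"
  shows "\<exists>Z\<in>interval X Y. dim Z = dim X + 1"
  using X
proof (cases rule: near_nondegenerate_cases)
  case 1
  have sX: "subspace X" and sY: "subspace Y" using X Y by (auto simp: near_nondegenerate_def)
  have "\<exists>r. Rad form Y = span {r}"
    using Y by (cases rule: near_nondegenerate_cases) (auto intro: exI[of _ 0])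
  then obtain r where r: "Rad form Y = span {r}" by blast
  have "dim (span (insert r X)) < dim Y" using dim_span_insert_le[of r X] XY by linarith
  then obtain p where p: "p \<in> Y" "p \<notin> span (insert r X)"
    using exists_mem_diff_of_dim_less by blast
  let ?Z = "span (insert p X)"
  have pX: "p \<notin> X" using p subset_span_insert by blast
  have dZ: "dim ?Z = dim X + 1" using sX pX by (rule dim_span_insert)
  have ZY: "?Z \<subseteq> Y" using span_insert_subset[OF sY] p XY by (simp add: precedes_def)
  have "v = 0" if v: "v \<in> ?Z" "v \<in> Rad form Y" for v
  proof -
    obtain k a where a: "a \<in> X" "v = a + k *s p"
      using v unfolding mem_span_insert[OF sX] by blast
    have "k = 0"
    proof (rule ccontr)
      assume k: "k \<noteq> 0"
      obtain c where c: "v = c *s r" using v r by (auto simp: span_singleton)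
      have "p = (1 / k) *s (v - a)" using a k by simp
      also have "\<dots> = - ((1 / k) *s a) + (c / k) *s r"
        by (simp add: c scale_right_diff_distrib)
      finally have "p = - ((1 / k) *s a) + (c / k) *s r" .
      moreover have "- ((1 / k) *s a) \<in> X" using a sX by (intro subspace_neg subspace_scale)
      ultimately show False using p(2) unfolding mem_span_insert[OF sX] by blast
    qed
    then show ?thesis using a v XY by (auto simp: precedes_def)
  qed
  then have "?Z \<prec> Y"
    using ZY dZ XY zero_mem_Rad[OF sY] unfolding precedes_def by (auto simp: span_zero)
  moreover have "X \<prec> ?Z"
    using 1 dZ by (intro nondegenerate_precedes) (auto intro: subset_span_insert[THEN subsetD])
  moreover have "near_nondegenerate ?Z"
    using dim_Rad_span_insert_le_one[OF sX 1] by (simp add: near_nondegenerate_def)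
  ultimately show ?thesis using dZ by (auto simp: interval_def)
next
  case (2 x)
  have sX: "subspace X" and sY: "subspace Y" using X Y by (auto simp: near_nondegenerate_def)
  have "x \<in> Rad form X" using 2 by (simp add: span_base)
  then have xX: "x \<in> X" by (simp add: mem_Rad)
  then obtain y where y: "y \<in> Y" "form x y \<noteq> 0" using exists_not_perp XY 2 by blast
  let ?Z = "span (insert y X)"
  have Z0: "Rad form ?Z = {0}" using sX 2(2) y(2) by (rule Rad_span_insert_eq_zero)
  have dZ: "dim ?Z = dim X + 1"
    using sX not_mem_of_not_perp_Rad[OF 2(2) y(2)] by (rule dim_span_insert)
  have "?Z \<subseteq> Y" using span_insert_subset[OF sY] y XY by (simp add: precedes_def)
  then have "?Z \<prec> Y" using nondegenerate_precedes Z0 dZ XY sY by simp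
  moreover have "X \<prec> ?Z"
    unfolding precedes_def using Z0 dZ subspace_0[OF sX] subset_span_insert by auto
  moreover have "near_nondegenerate ?Z" using Z0 by (simp add: nondegenerate_near)
  ultimately show ?thesis using dZ by (auto simp: interval_def)
qed

section \<open>Connectedness of intervals\<close>

lemma comparability_step:
  "P \<in> S \<Longrightarrow> Q \<in> S \<Longrightarrow> P \<prec> Q \<or> Q \<prec> P \<Longrightarrow> (P, Q) \<in> (comparability S)\<^sup>*"
  by (auto simp: comparability_def)

lemma comparability_rtrancl_sym:
  "(P, Q) \<in> (comparability S)\<^sup>* \<Longrightarrow> (Q, P) \<in> (comparability S)\<^sup>*"
  by (rule symD[OF sym_rtrancl]) (auto simp: comparability_def sym_def)

lemma comparability_common_upper_bound:
  "\<lbrakk>P \<in> S; Q \<in> S; T \<in> S; P \<prec> T; Q \<prec> T\<rbrakk> \<Longrightarrow> (P, Q) \<in> (comparability S)\<^sup>*"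
  by (meson comparability_step rtrancl_trans)

lemma eq_span_insert:
  assumes "subspace A" "subspace Z" "A \<subseteq> Z" "dim Z = dim A + 1" "p \<in> Z" "p \<notin> A"
  shows "Z = span (insert p A)"
  using subspace_dim_equal[of "span (insert p A)" Z] span_insert_subset[of Z A p]
    dim_span_insert[of A p] assms by simp

text \<open>The path runs \<open>P\<close>, \<open>P + \<langle>r\<rangle>\<close>, \<open>X + \<langle>r\<rangle>\<close>, \<open>Q + \<langle>r\<rangle>\<close>, \<open>Q\<close>, with one vector \<open>r\<close> of \<open>Y\<close> that is not
  orthogonal to the radicals of \<open>P\<close> and \<open>Q\<close>. It exists because neither radical lies in \<open>Rad Y\<close>.\<close>
lemma minimal_elements_connected_nondegenerate:
  assumes X: "near_nondegenerate X" and Y: "near_nondegenerate Y"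
    and gap: "dim X + 3 \<le> dim Y" and X0: "Rad form X = {0}"
    and P: "P \<in> interval X Y" "dim P = dim X + 1"
    and Q: "Q \<in> interval X Y" "dim Q = dim X + 1"
  shows "(P, Q) \<in> (comparability (interval X Y))\<^sup>*"
proof -
  have sX: "subspace X" and sY: "subspace Y" using X Y by (auto simp: near_nondegenerate_def)
  have line: "\<exists>p'. p' \<noteq> 0 \<and> Rad form Z = span {p'} \<and> p' \<in> Z \<and> (\<exists>y\<in>Y. form p' y \<noteq> 0)"
    if Z: "Z \<in> interval X Y" "dim Z = dim X + 1" for Z
  proof -
    have sZ: "subspace Z" and XZ: "X \<subseteq> Z" and ZY: "Z \<prec> Y"
      using Z by (auto simp: interval_def near_nondegenerate_def precedes_def)
    obtain p where p: "p \<in> Z" "p \<notin> X" using exists_mem_diff_of_dim_less[of X Z] Z by auto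
    have "Z = span (insert p X)" using sX sZ XZ Z(2) p by (rule eq_span_insert)
    then obtain p' where p': "p' \<noteq> 0" "Rad form Z = span {p'}"
      using exists_Rad_span_insert[OF sX X0 p(2)] by auto
    then have "p' \<in> Rad form Z" by (simp add: span_base)
    then have "p' \<in> Z" by (simp add: mem_Rad)
    then show ?thesis using p' exists_not_perp[OF ZY] by blast
  qed
  obtain p where p: "p \<noteq> 0" "Rad form P = span {p}" "p \<in> P" "\<exists>y\<in>Y. form p y \<noteq> 0"
    using line[OF P] by blast
  obtain q where q: "q \<noteq> 0" "Rad form Q = span {q}" "q \<in> Q" "\<exists>y\<in>Y. form q y \<noteq> 0"
    using line[OF Q] by blast
  obtain r where r: "r \<in> Y" "form p r \<noteq> 0" "form q r \<noteq> 0"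
    using exists_mem_outside_two_subspaces[OF sY subspace_perp_vector[of p] subspace_perp_vector[of q]]
      p(4) q(4) by blast
  let ?R = "span (insert r X)"
  \<comment> \<open>\<open>r\<close> is not orthogonal to the radical of \<open>Z\<close>, so \<open>Z + \<langle>r\<rangle>\<close> is nondegenerate\<close>
  have path: "(Z, ?R) \<in> (comparability (interval X Y))\<^sup>*"
    if Z: "Z \<in> interval X Y" "dim Z = dim X + 1" "Rad form Z = span {z}" "form z r \<noteq> 0" for Z z
  proof -
    have sZ: "subspace Z" and XZ: "X \<subseteq> Z" and ZY: "Z \<subseteq> Y" and XpZ: "X \<prec> Z"
      using Z by (auto simp: interval_def near_nondegenerate_def precedes_def)
    let ?T = "span (insert r Z)"
    have rZ: "r \<notin> Z" using Z by (intro not_mem_of_not_perp_Rad)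
    then have rX: "r \<notin> X" using XZ by blast
    have T0: "Rad form ?T = {0}" using sZ Z(3,4) by (rule Rad_span_insert_eq_zero)
    have dT: "dim ?T = dim X + 2" using dim_span_insert[OF sZ rZ] Z by simp
    have TY: "?T \<prec> Y"
      using T0 span_insert_subset[OF sY ZY r(1)] dT gap sY by (intro nondegenerate_precedes) auto
    have dR: "dim ?R = dim X + 1" using sX rX by (rule dim_span_insert)
    have XR: "X \<prec> ?R"
      using X0 subset_span_insert dR by (intro nondegenerate_precedes) auto
    have RT: "?R \<prec> ?T"
      unfolding precedes_def
      using T0 dR dT span_mono[OF insert_mono[OF XZ], of r] by (auto simp: span_zero)
    have ZT: "Z \<prec> ?T"
      unfolding precedes_def using T0 dT Z subset_span_insert subspace_0[OF sZ] by auto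
    have "?R \<in> interval X Y"
      using XR RT TY dim_Rad_span_insert_le_one[OF sX X0]
      by (auto simp: interval_def near_nondegenerate_def intro: precedes_trans)
    moreover have "?T \<in> interval X Y"
      using XpZ ZT TY T0 by (auto simp: interval_def intro: precedes_trans nondegenerate_near)
    ultimately show ?thesis using Z ZT RT by (intro comparability_common_upper_bound)
  qed
  have "(P, ?R) \<in> (comparability (interval X Y))\<^sup>*" using path P p r by blast
  moreover have "(Q, ?R) \<in> (comparability (interval X Y))\<^sup>*" using path Q q r by blast
  ultimately show ?thesis by (meson comparability_rtrancl_sym rtrancl_trans)
qed

text \<open>Here \<open>P\<close> and \<open>Q\<close> are nondegenerate, so only the condition at \<open>Y\<close> can fail for \<open>P + Q\<close>. If it
  does, \<open>Rad Y\<close> is a line inside \<open>P + Q\<close>, and the path is led through a minimal element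
  \<open>X + \<langle>w\<rangle>\<close> with \<open>w\<close> outside \<open>P + Q\<close>.\<close>
lemma minimal_elements_connected_degenerate:
  assumes X: "near_nondegenerate X" and Y: "near_nondegenerate Y"
    and XY: "X \<prec> Y" and gap: "dim X + 3 \<le> dim Y"
    and x: "x \<noteq> 0" "Rad form X = span {x}"
    and P: "P \<in> interval X Y" "dim P = dim X + 1"
    and Q: "Q \<in> interval X Y" "dim Q = dim X + 1"
  shows "(P, Q) \<in> (comparability (interval X Y))\<^sup>*"
proof -
  let ?I = "interval X Y"
  have sX: "subspace X" and sY: "subspace Y" using X Y by (auto simp: near_nondegenerate_def)
  have "x \<in> Rad form X" using x by (simp add: span_base)
  then have xX: "x \<in> X" by (simp add: mem_Rad)
  have gen: "\<exists>y\<in>Y. form x y \<noteq> 0 \<and> Z = span (insert y X)"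
    if Z: "Z \<in> ?I" "dim Z = dim X + 1" for Z
  proof -
    have Z': "subspace Z" "X \<prec> Z" "X \<subseteq> Z" "Z \<subseteq> Y"
      using Z by (auto simp: interval_def near_nondegenerate_def precedes_def)
    then obtain y where y: "y \<in> Z" "form x y \<noteq> 0" using exists_not_perp xX x by blast
    then have "Z = span (insert y X)"
      using not_mem_of_not_perp_Rad[OF x(2) y(2)] sX Z' Z by (intro eq_span_insert)
    then show ?thesis using y Z' by blast
  qed
  have Rad0: "Rad form (span (insert y X)) = {0}" if "form x y \<noteq> 0" for y
    using sX x(2) that by (rule Rad_span_insert_eq_zero)
  have min: "span (insert y X) \<in> ?I" "dim (span (insert y X)) = dim X + 1"
    if y: "y \<in> Y" "form x y \<noteq> 0" for y
  proof -
    let ?Z = "span (insert y X)"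
    show d: "dim ?Z = dim X + 1"
      using sX not_mem_of_not_perp_Rad[OF x(2) y(2)] by (rule dim_span_insert)
    have "X \<prec> ?Z"
      unfolding precedes_def using Rad0[OF y(2)] d subset_span_insert subspace_0[OF sX] by auto
    moreover have "?Z \<prec> Y"
      using Rad0[OF y(2)] span_insert_subset[OF sY _ y(1), of X] XY d gap sY
      by (intro nondegenerate_precedes) (auto simp: precedes_def)
    ultimately show "?Z \<in> ?I"
      using Rad0[OF y(2)] by (simp add: interval_def nondegenerate_near)
  qed
  have join: "(span (insert y X), span (insert z X)) \<in> (comparability ?I)\<^sup>*"
    if y: "y \<in> Y" "form x y \<noteq> 0" and z: "z \<in> Y" "form x z \<noteq> 0" and yz: "z \<notin> span (insert y X)"
      and avoid: "span (insert z (span (insert y X))) \<inter> Rad form Y \<subseteq> {0}" for y z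
  proof -
    let ?A = "span (insert y X)" and ?B = "span (insert z X)"
    let ?T = "span (insert z ?A)"
    have dT: "dim ?T = dim X + 2" using dim_span_insert[OF _ yz] min(2)[OF y] by simp
    have nT: "near_nondegenerate ?T"
      using dim_Rad_span_insert_le_one[OF _ Rad0[OF y(2)]] by (simp add: near_nondegenerate_def)
    have AT: "?A \<prec> ?T"
      using Rad0[OF y(2)] subset_span_insert[of ?A] dT min(2)[OF y]
      by (intro nondegenerate_precedes) auto
    have "insert z X \<subseteq> insert z ?A" using subset_span_insert by blast
    then have "?B \<subseteq> ?T" by (rule span_mono)
    then have BT: "?B \<prec> ?T"
      using Rad0[OF z(2)] dT min(2)[OF z] by (intro nondegenerate_precedes) auto
    have "?A \<subseteq> Y" using min(1)[OF y] by (simp add: interval_def precedes_def)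
    then have "?T \<subseteq> Y" using z(1) by (rule span_insert_subset[OF sY])
    then have "?T \<prec> Y"
      using avoid dT gap zero_mem_Rad[OF sY] by (auto simp: precedes_def span_zero)
    moreover have "X \<prec> ?T" using AT min(1)[OF y] precedes_trans by (auto simp: interval_def)
    ultimately have "?T \<in> ?I" using nT by (simp add: interval_def)
    then show ?thesis using AT BT min(1)[OF y] min(1)[OF z]
      by (intro comparability_common_upper_bound)
  qed
  obtain y where y: "y \<in> Y" "form x y \<noteq> 0" "P = span (insert y X)" using gen[OF P] by blast
  obtain z where z: "z \<in> Y" "form x z \<noteq> 0" "Q = span (insert z X)" using gen[OF Q] by blast
  let ?T = "span (insert z P)"
  show ?thesis
  proof (cases "z \<in> P")
    case True
    have sP: "subspace P" and XP: "X \<subseteq> P"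
      using P by (auto simp: interval_def near_nondegenerate_def precedes_def)
    have "P = Q"
      unfolding z(3)
      using sX sP XP P(2) True not_mem_of_not_perp_Rad[OF x(2) z(2)] by (rule eq_span_insert)
    then show ?thesis by simp
  next
    case zP: False
    show ?thesis
    proof (cases "?T \<inter> Rad form Y \<subseteq> {0}")
      case True
      then show ?thesis using join y z zP by blast
    next
      case False
      then obtain r where r: "r \<in> ?T" "r \<in> Rad form Y" "r \<noteq> 0" by blast
      have RY: "Rad form Y = span {r}"
        using Y r subspace_dim_le_one[OF subspace_Rad] by (simp add: near_nondegenerate_def)
      have RT: "Rad form Y \<subseteq> ?T" unfolding RY using r by (intro span_minimal) auto
      have "dim ?T < dim Y" using dim_span_insert_le[of z P] P gap by linarith
      then obtain a where a: "a \<in> Y" "a \<notin> ?T" using exists_mem_diff_of_dim_less by blast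
      then obtain w where w: "w \<in> Y" "w \<notin> ?T" "form x w \<noteq> 0"
        using exists_mem_outside_two_subspaces[OF sY subspace_span subspace_perp_vector[of x] a, of y]
          y by blast
      \<comment> \<open>\<open>Rad Y\<close> lies in \<open>?T\<close> and \<open>w\<close> does not, so for \<open>Z = X + \<langle>u\<rangle> \<subseteq> ?T\<close> any common
        vector of \<open>Z + \<langle>w\<rangle>\<close> and \<open>Rad Y\<close> lies in \<open>Z \<inter> Rad Y = 0\<close>\<close>
      have detour: "(span (insert u X), span (insert w X)) \<in> (comparability ?I)\<^sup>*"
        if u: "u \<in> Y" "form x u \<noteq> 0" "span (insert u X) \<subseteq> ?T" for u
      proof (rule join)
        let ?Z = "span (insert u X)"
        show "w \<notin> ?Z" using w u by blast
        show "span (insert w ?Z) \<inter> Rad form Y \<subseteq> {0}"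
        proof
          fix v assume v: "v \<in> span (insert w ?Z) \<inter> Rad form Y"
          then obtain k b where b: "b \<in> ?Z" "v = b + k *s w"
            using mem_span_insert[of ?Z v w] by auto
          have "k *s w = v - b" using b by simp
          then have "k *s w \<in> ?T" using v b u RT by (metis IntD2 span_diff subsetD)
          then have "k = 0"
            using w(2) span_scale[of "k *s w" "insert z P" "1 / k"] by (auto split: if_splits)
          then have "v \<in> ?Z \<inter> Rad form Y" using b v by simp
          also have "\<dots> = {0}" using min(1)[OF u(1,2)] by (simp add: interval_def precedes_def)
          finally show "v \<in> {0}" .
        qed
      qed (use u w in auto)
      have "P \<subseteq> ?T" by (rule subset_span_insert)
      moreover have "Q \<subseteq> ?T"
        unfolding z(3) y(3) by (intro span_mono insert_mono) (rule subset_span_insert)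
      ultimately show ?thesis
        using detour[OF y(1,2)] detour[OF z(1,2)] unfolding y(3) z(3)
        by (meson comparability_rtrancl_sym rtrancl_trans)
    qed
  qed
qed

lemma minimal_elements_connected:
  assumes "near_nondegenerate X" "near_nondegenerate Y" "X \<prec> Y" "dim X + 3 \<le> dim Y"
    and "P \<in> interval X Y" "dim P = dim X + 1" "Q \<in> interval X Y" "dim Q = dim X + 1"
  shows "(P, Q) \<in> (comparability (interval X Y))\<^sup>*"
  using assms(1)
  by (cases rule: near_nondegenerate_cases)
    (use assms minimal_elements_connected_nondegenerate minimal_elements_connected_degenerate
      in blast)+

text \<open>Every element of the interval is joined to a minimal one by \<open>descend\<close>.\<close>
lemma interval_connected:
  assumes X: "near_nondegenerate X" and Y: "near_nondegenerate Y"
    and XY: "X \<prec> Y" "dim X + 3 \<le> dim Y"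
    and U: "U \<in> interval X Y" and W: "W \<in> interval X Y"
  shows "(U, W) \<in> (comparability (interval X Y))\<^sup>*"
proof -
  have down: "\<exists>P\<in>interval X Y. dim P = dim X + 1 \<and> (U, P) \<in> (comparability (interval X Y))\<^sup>*"
    if U: "U \<in> interval X Y" for U
  proof (cases "dim U = dim X + 1")
    case True
    then show ?thesis using U by blast
  next
    case False
    have U': "near_nondegenerate U" "X \<prec> U" "U \<prec> Y" using U by (auto simp: interval_def)
    then have "dim X + 2 \<le> dim U" using precedes_dim[of X U] False by linarith
    then obtain P where P: "P \<in> interval X U" "dim P = dim X + 1"
      using descend[OF X U'(1,2)] by blast
    then have "P \<in> interval X Y" "P \<prec> U" using U' precedes_trans by (auto simp: interval_def)
    then show ?thesis using P U comparability_step by blast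
  qed
  obtain P Q where "P \<in> interval X Y" "dim P = dim X + 1" "(U, P) \<in> (comparability (interval X Y))\<^sup>*"
    "Q \<in> interval X Y" "dim Q = dim X + 1" "(W, Q) \<in> (comparability (interval X Y))\<^sup>*"
    using down[OF U] down[OF W] by blast
  then show ?thesis
    using minimal_elements_connected[OF X Y XY]
    by (meson comparability_rtrancl_sym rtrancl_trans)
qed

end

section \<open>Residues of flags\<close>

text \<open>The incidence graph omits loops, which does not affect reachability.\<close>
lemma connected_pregeometryI:
  assumes ne: "objects G \<noteq> {}"
    and path: "\<And>x y. x \<in> objects G \<Longrightarrow> y \<in> objects G \<Longrightarrow>
      (x, y) \<in> {(x, y). x \<in> objects G \<and> y \<in> objects G \<and> incident G x y}\<^sup>*"
  shows "connected_pregeometry G"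
proof -
  let ?r = "{(x, y). x \<in> objects G \<and> y \<in> objects G \<and> incident G x y}"
  let ?D = "mk_symmetric (with_proj (incidence_graph G))"
  have D: "parcs ?D \<supseteq> {(x, y). x \<in> objects G \<and> y \<in> objects G \<and> x \<noteq> y \<and> incident G x y}"
    by (auto simp: parcs_mk_symmetric incidence_graph_def)
  have "(x, y) \<in> rtrancl_on (objects G) (parcs ?D)" if "(x, y) \<in> ?r\<^sup>*" "x \<in> objects G" for x y
    using that
  proof (induction rule: rtrancl_induct)
    case base
    then show ?case by simp
  next
    case (step y z)
    show ?case
    proof (cases "y = z")
      case False
      then have "(y, z) \<in> parcs ?D" using D step by blast
      then show ?thesis using step by (auto intro: rtrancl_on_into_rtrancl_on)
    qed (use step in simp)
  qed
  then show ?thesis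
    unfolding connected_pregeometry_def connected_def strongly_connected_def reachable_def
    using ne path by (simp add: incidence_graph_def)
qed

context symplectic_form_space
begin

text \<open>Maximal rank enters through \<open>near_nondegenerate UNIV\<close> below; here the conditions on the
  dimension and on \<open>Rad V\<close> are recognised as \<open>{0} \<prec> U\<close> and \<open>U \<prec> V\<close>.\<close>
lemma objects_Gamma: "objects (Gamma form) = interval {0} UNIV"
proof -
  have "{0} \<prec> U \<longleftrightarrow> 1 \<le> dim U" if "subspace U" for U
    unfolding precedes_def using zero_mem_Rad[OF that] subspace_0[OF that]
    by (auto simp: Suc_le_eq simp del: dim_eq_0)
  then show ?thesis
    by (auto simp: Gamma_def interval_def near_nondegenerate_def precedes_def)
qed

lemma incident_Gamma: "incident (Gamma form) X Y \<longleftrightarrow> X = Y \<or> X \<prec> Y \<or> Y \<prec> X"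
  by (auto simp: Gamma_def precedes_def)

lemma near_nondegenerate_UNIV:
  assumes "maximal_rank form"
  shows "near_nondegenerate UNIV"
  using assms by (simp add: maximal_rank_def near_nondegenerate_def split: if_splits)

lemma near_nondegenerate_zero: "near_nondegenerate {0}"
  by (rule nondegenerate_near) (auto simp: mem_Rad)

lemma zero_precedes_UNIV: "1 \<le> dim UNIV \<Longrightarrow> {0} \<prec> UNIV"
  using zero_mem_Rad[of UNIV] by (simp add: precedes_def)

text \<open>The members of the chain just below and just above a dimension that the chain omits.\<close>
lemma chain_gap:
  assumes chain: "\<And>X Y. X \<in> C \<Longrightarrow> Y \<in> C \<Longrightarrow> X = Y \<or> X \<prec> Y \<or> Y \<prec> X"
    and ends: "{0} \<in> C" "UNIV \<in> C"
    and t: "0 < t" "t < dim UNIV" "t \<notin> dim ` C"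
  shows "\<exists>X\<in>C. \<exists>Y\<in>C. X \<prec> Y \<and> dim X < t \<and> t < dim Y \<and> (\<forall>Z\<in>C. dim Z \<le> dim X \<or> dim Y \<le> dim Z)"
proof -
  have "\<exists>X. (X \<in> C \<and> dim X < t) \<and> (\<forall>Z. Z \<in> C \<and> dim Z < t \<longrightarrow> dim Z \<le> dim X)"
    using ends t by (intro ex_has_greatest_nat[of _ "{0}" _ t]) auto
  then obtain X where X: "X \<in> C" "dim X < t" "\<And>Z. Z \<in> C \<Longrightarrow> dim Z < t \<Longrightarrow> dim Z \<le> dim X"
    by blast
  have "\<exists>Y. (Y \<in> C \<and> t < dim Y) \<and> (\<forall>Z. Z \<in> C \<and> t < dim Z \<longrightarrow> dim Y \<le> dim Z)"
    using ends t by (intro ex_has_least_nat[of _ UNIV]) auto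
  then obtain Y where Y: "Y \<in> C" "t < dim Y" "\<And>Z. Z \<in> C \<Longrightarrow> t < dim Z \<Longrightarrow> dim Y \<le> dim Z"
    by blast
  have "X \<prec> Y" using chain[OF X(1) Y(1)] X(2) Y(2) by (auto dest: precedes_dim)
  moreover have "dim Z \<le> dim X \<or> dim Y \<le> dim Z" if "Z \<in> C" for Z
    using X(3)[OF that] Y(3)[OF that] t(3) that by (metis image_eqI linorder_neqE_nat)
  ultimately show ?thesis using X Y by blast
qed

text \<open>An object of the residue lies in the interval between two successive members of the chain.
  Another object of the residue outside that interval is incident with it; one inside is joined
  to it by \<open>interval_connected\<close> if the interval contains at least two dimensions. Otherwise the rank
  provides a second omitted dimension, and so an object of another interval, incident with both.\<close>
lemma connected_residue:
  assumes max: "maximal_rank form" and n: "2 \<le> dim UNIV"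
    and F: "is_flag (Gamma form) F" and rank: "2 \<le> residue_rank (Gamma form) F"
  shows "connected_pregeometry (residue (Gamma form) F)"
proof -
  define C where "C = insert {0} (insert UNIV F)"
  define S where "S = {U \<in> interval {0} UNIV - F. \<forall>Y\<in>F. U = Y \<or> U \<prec> Y \<or> Y \<prec> U}"
  have objs: "objects (residue (Gamma form) F) = S"
    by (auto simp: residue_def S_def objects_Gamma incident_Gamma)
  have FI: "F \<subseteq> interval {0} UNIV"
    using F by (simp add: is_flag_def objects_Gamma)
  have Fchain: "X = Y \<or> X \<prec> Y \<or> Y \<prec> X" if "X \<in> F" "Y \<in> F" for X Y
    using F that by (simp add: is_flag_def incident_Gamma)
  have chain: "X = Y \<or> X \<prec> Y \<or> Y \<prec> X" if "X \<in> C" "Y \<in> C" for X Y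
    using that FI Fchain[of X Y] zero_precedes_UNIV n
    by (auto simp: C_def interval_def)
  have ends: "{0} \<in> C" "UNIV \<in> C" by (auto simp: C_def)
  have near: "near_nondegenerate X" if "X \<in> C" for X
    using that FI near_nondegenerate_zero near_nondegenerate_UNIV[OF max]
    by (auto simp: C_def interval_def)
  have cmp: "U \<prec> Z \<or> Z \<prec> U" if "U \<in> S" "Z \<in> C" for U Z
    using that by (auto simp: S_def C_def interval_def)
  have dimS: "0 < dim U" "dim U < dim UNIV" "dim U \<notin> dim ` C" if U: "U \<in> S" for U
  proof -
    show "0 < dim U" "dim U < dim UNIV" using U by (auto simp: S_def interval_def dest: precedes_dim)
    show "dim U \<notin> dim ` C" using cmp[OF U] by (fastforce dest: precedes_dim)
  qed
  have gap: "\<exists>X\<in>C. \<exists>Y\<in>C. X \<prec> Y \<and> dim X < t \<and> t < dim Y \<and> (\<forall>Z\<in>C. dim Z \<le> dim X \<or> dim Y \<le> dim Z)"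
    if "0 < t" "t < dim UNIV" "t \<notin> dim ` C" for t
    using chain_gap[OF chain ends that] .
  have intervalS: "interval X Y \<subseteq> S"
    if XY: "X \<in> C" "Y \<in> C" and succ: "\<forall>Z\<in>C. dim Z \<le> dim X \<or> dim Y \<le> dim Z" for X Y
  proof
    fix U assume "U \<in> interval X Y"
    then have U: "near_nondegenerate U" "X \<prec> U" "U \<prec> Y" by (auto simp: interval_def)
    have UZ: "U \<prec> Z \<or> Z \<prec> U" if Z: "Z \<in> C" for Z
    proof (cases "dim Z \<le> dim X")
      case True
      then have "Z = X \<or> Z \<prec> X" using chain[OF Z XY(1)] by (auto dest: precedes_dim)
      then show ?thesis using U precedes_trans by blast
    next
      case False
      then have "dim Y \<le> dim Z" using succ Z by blast
      then have "Z = Y \<or> Y \<prec> Z" using chain[OF Z XY(2)] by (auto dest: precedes_dim)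
      then show ?thesis using U precedes_trans by blast
    qed
    have "{0} \<prec> U" "U \<prec> UNIV"
      using UZ[OF ends(1)] UZ[OF ends(2)] dim_subset[of U UNIV]
      by (auto dest!: precedes_dim simp del: dim_UNIV)
    moreover have "U \<notin> F" using UZ[of U] by (auto simp: C_def dest: precedes_dim)
    ultimately show "U \<in> S"
      using U UZ by (auto simp: S_def interval_def C_def)
  qed
  have adj: "(U, W) \<in> (comparability S)\<^sup>*" if "U \<in> S" "W \<in> S" "U \<prec> W \<or> W \<prec> U" for U W
    using that by (rule comparability_step)

  define T where "T = {1..dim UNIV - 1} - dim ` F"
  have T: "0 < t \<and> t < dim UNIV \<and> t \<notin> dim ` C" if "t \<in> T" for t
    using that by (auto simp: T_def C_def simp del: dim_UNIV)
  have "inj_on dim F" using Fchain by (intro inj_onI) (metis precedes_dim less_irrefl)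
  then have "card (dim ` F) = card F" by (rule card_image)
  moreover have "dim ` F \<subseteq> {1..dim UNIV - 1}"
    using F by (auto simp: is_flag_def Gamma_def)
  then have "card {1..dim UNIV - 1} - card (dim ` F) \<le> card T"
    unfolding T_def by (intro diff_card_le_card_Diff) (rule finite_subset, auto)
  moreover have "2 \<le> card {1..dim UNIV - 1} - card F"
    using rank by (simp add: residue_rank_def Gamma_def)
  ultimately have T2: "2 \<le> card T" by simp
  have witness: "\<exists>X\<in>C. \<exists>Y\<in>C. X \<prec> Y \<and> dim X < t \<and> t < dim Y \<and> (\<exists>Z\<in>S. X \<prec> Z \<and> Z \<prec> Y) \<and>
      (\<forall>Z\<in>C. dim Z \<le> dim X \<or> dim Y \<le> dim Z)" if t: "t \<in> T" for t
  proof -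
    obtain X Y where XY: "X \<in> C" "Y \<in> C" "X \<prec> Y" "dim X < t" "t < dim Y"
      "\<forall>Z\<in>C. dim Z \<le> dim X \<or> dim Y \<le> dim Z"
      using gap T[OF t] by meson
    then have "dim X + 2 \<le> dim Y" by linarith
    then obtain Z where "Z \<in> interval X Y" using descend[OF near near] XY by blast
    then have "Z \<in> S" "X \<prec> Z" "Z \<prec> Y"
      using intervalS[OF XY(1,2,6)] by (auto simp: interval_def)
    then show ?thesis using XY by blast
  qed

  have "S \<noteq> {}"
  proof -
    have "T \<noteq> {}" using T2 by auto
    then show ?thesis using witness by blast
  qed
  moreover have "(U, W) \<in> (comparability S)\<^sup>*" if U: "U \<in> S" and W: "W \<in> S" for U W
  proof -
    obtain X Y where XY: "X \<in> C" "Y \<in> C" "X \<prec> Y" "dim X < dim U" "dim U < dim Y"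
      and succ: "\<forall>Z\<in>C. dim Z \<le> dim X \<or> dim Y \<le> dim Z"
      using gap[OF dimS[OF U]] by meson
    have inside: "P \<in> interval X Y" if "P \<in> S" "dim X < dim P" "dim P < dim Y" for P
      using that cmp[OF that(1) XY(1)] cmp[OF that(1) XY(2)]
      by (auto simp: interval_def S_def dest: precedes_dim)
    have outside: "(P, Q) \<in> (comparability S)\<^sup>*"
      if P: "P \<in> interval X Y" and Q: "Q \<in> S" and out: "dim Q < dim X \<or> dim Y < dim Q" for P Q
    proof -
      have "Q \<prec> X \<or> Y \<prec> Q"
        using cmp[OF Q XY(1)] cmp[OF Q XY(2)] out by (auto dest: precedes_dim)
      then have "P \<prec> Q \<or> Q \<prec> P" using P precedes_trans unfolding interval_def by blast
      then show ?thesis using adj Q P intervalS[OF XY(1,2) succ] by blast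
    qed
    have UI: "U \<in> interval X Y" using inside U XY by blast
    show ?thesis
    proof (cases "W \<in> interval X Y")
      case False
      then have "\<not> (dim X < dim W \<and> dim W < dim Y)" using inside W by blast
      moreover have "dim W \<noteq> dim X" "dim W \<noteq> dim Y" using dimS(3)[OF W] XY by auto
      ultimately show ?thesis using outside UI W by (meson linorder_neqE_nat)
    next
      case WI: True
      show ?thesis
      proof (cases "dim X + 3 \<le> dim Y")
        case True
        have "comparability (interval X Y) \<subseteq> comparability S"
          using intervalS[OF XY(1,2) succ] by (auto simp: comparability_def)
        then show ?thesis
          using interval_connected[OF near[OF XY(1)] near[OF XY(2)] XY(3) True UI WI]
            rtrancl_mono by blast
      next
        case False
        have "T - {dim U} \<noteq> {}"
        proof
          assume "T - {dim U} = {}"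
          then have "card T \<le> card {dim U}" by (intro card_mono) auto
          then show False using T2 by simp
        qed
        then obtain t where t: "t \<in> T" "t \<noteq> dim U" by blast
        have "t \<noteq> dim X" "t \<noteq> dim Y" using T[OF t(1)] XY by auto
        then have t': "t < dim X \<or> dim Y < t" using False t(2) XY(4,5) by linarith
        obtain X' Y' Z where Z: "Z \<in> S" "X' \<prec> Z" "Z \<prec> Y'" "dim X' < t" "t < dim Y'"
          and succ': "\<forall>Z\<in>C. dim Z \<le> dim X' \<or> dim Y' \<le> dim Z"
          using witness[OF t(1)] by blast
        have "dim Z < dim X \<or> dim Y < dim Z"
          using t' Z succ' XY(1,2) precedes_dim[OF Z(2)] precedes_dim[OF Z(3)] by fastforce
        then show ?thesis
          using outside[OF UI Z(1)] outside[OF WI Z(1)]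
          by (meson comparability_rtrancl_sym rtrancl_trans)
      qed
    qed
  qed
  moreover have "comparability S \<subseteq> {(x, y). x \<in> S \<and> y \<in> S \<and> incident (residue (Gamma form) F) x y}"
    by (auto simp: comparability_def residue_def incident_Gamma)
  ultimately show ?thesis
    unfolding objs[symmetric] using rtrancl_mono by (intro connected_pregeometryI) blast+
qed

end

theorem lemma3p10:
  fixes scale :: "'f::field \<Rightarrow> 'v::ab_group_add \<Rightarrow> 'v"
    and Basis :: "'v set"
    and form :: "'v \<Rightarrow> 'v \<Rightarrow> 'f"
  assumes "symplectic_form_space scale Basis form"
    and "vector_space.dim scale (UNIV :: 'v set) \<ge> 2"
    and "vector_space.maximal_rank scale form"
  shows "residually_connected (vector_space.Gamma scale form)"
proof -
  interpret symplectic_form_space scale Basis form by fact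
  show ?thesis
    unfolding residually_connected_def using connected_residue assms(2,3) by blast
qed

end
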